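(* Let $G\le\mathrm{Sym}(\Omega)$ be a finite primitive permutation group which is not almost simple. Then $\kappa(G)=1$ if and only if $G$ is sharply $2$-transitive.
   Context: A derangement is an element of $G$ fixing no point of $\Omega$; $\kappa(G)$ is the number of conjugacy classes of $G$ consisting of derangements. $G$ is sharply $2$-transitive if it acts regularly on ordered pairs of distinct points of $\Omega$. *)

theory Defs
  imports "HOL-Algebra.Algebra"
begin

definition perm_group :: "'a set \<Rightarrow> ('a \<Rightarrow> 'a) set \<Rightarrow> bool" where
  "perm_group \<Omega> G \<longleftrightarrow> subgroup G (BijGroup \<Omega>)"

abbreviation PG :: "'a set \<Rightarrow> ('a \<Rightarrow> 'a) set \<Rightarrow> ('a \<Rightarrow> 'a) monoid" where
  "PG \<Omega> G \<equiv> (BijGroup \<Omega>)\<lparr>carrier := G\<rparr>"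

definition transitive_on :: "'a set \<Rightarrow> ('a \<Rightarrow> 'a) set \<Rightarrow> bool" where
  "transitive_on \<Omega> G \<longleftrightarrow> \<Omega> \<noteq> {} \<and> (\<forall>x\<in>\<Omega>. \<forall>y\<in>\<Omega>. \<exists>g\<in>G. g x = y)"

definition is_block :: "'a set \<Rightarrow> ('a \<Rightarrow> 'a) set \<Rightarrow> 'a set \<Rightarrow> bool" where
  "is_block \<Omega> G B \<longleftrightarrow> B \<subseteq> \<Omega> \<and> B \<noteq> {} \<and>
     (\<forall>g\<in>G. g ` B = B \<or> g ` B \<inter> B = {})"

definition primitive :: "'a set \<Rightarrow> ('a \<Rightarrow> 'a) set \<Rightarrow> bool" where
  "primitive \<Omega> G \<longleftrightarrow> transitive_on \<Omega> G \<and>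
     (\<forall>B. is_block \<Omega> G B \<longrightarrow> card B = 1 \<or> B = \<Omega>)"

definition derangement :: "'a set \<Rightarrow> ('a \<Rightarrow> 'a) \<Rightarrow> bool" where
  "derangement \<Omega> g \<longleftrightarrow> (\<forall>x\<in>\<Omega>. g x \<noteq> x)"

definition conj_class :: "('g, 'b) monoid_scheme \<Rightarrow> 'g \<Rightarrow> 'g set" where
  "conj_class H g = {h \<otimes>\<^bsub>H\<^esub> g \<otimes>\<^bsub>H\<^esub> inv\<^bsub>H\<^esub> h | h. h \<in> carrier H}"

definition kappa :: "'a set \<Rightarrow> ('a \<Rightarrow> 'a) set \<Rightarrow> nat" where
  "kappa \<Omega> G = card {C. \<exists>g\<in>G. C = conj_class (PG \<Omega> G) g \<and>
                                 (\<forall>h\<in>C. derangement \<Omega> h)}"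

definition sharply_2_transitive :: "'a set \<Rightarrow> ('a \<Rightarrow> 'a) set \<Rightarrow> bool" where
  "sharply_2_transitive \<Omega> G \<longleftrightarrow>
     (\<exists>x\<in>\<Omega>. \<exists>y\<in>\<Omega>. x \<noteq> y) \<and>
     (\<forall>x\<in>\<Omega>. \<forall>y\<in>\<Omega>. \<forall>x'\<in>\<Omega>. \<forall>y'\<in>\<Omega>. x \<noteq> y \<longrightarrow> x' \<noteq> y' \<longrightarrow>
        (\<exists>!g. g \<in> G \<and> g x = x' \<and> g y = y'))"

text \<open>Almost simple: G has a nonabelian simple normal subgroup T such that the conjugation
  action G \<rightarrow> Aut(T) is faithful, i.e. C_G(T) = 1 (equivalently T \<le> G \<le> Aut(T)).\<close>
definition almost_simple :: "('g, 'b) monoid_scheme \<Rightarrow> bool" where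
  "almost_simple H \<longleftrightarrow> (\<exists>T. T \<lhd> H \<and> simple_group (H\<lparr>carrier := T\<rparr>) \<and>
      \<not> comm_group (H\<lparr>carrier := T\<rparr>) \<and>
      (\<forall>g\<in>carrier H. (\<forall>t\<in>T. g \<otimes>\<^bsub>H\<^esub> t = t \<otimes>\<^bsub>H\<^esub> g) \<longrightarrow> g = \<one>\<^bsub>H\<^esub>))"

end

theory Submission
  imports Defs
begin

text \<open>
  If \<open>G\<close> is sharply 2-transitive of degree \<open>n\<close>, then \<open>|G| = n (n - 1)\<close>, and counting fixed points
  shows that \<open>n - 1\<close> elements are derangements. The centralizer of a derangement is semiregular, so
  has order at most \<open>n\<close>, and the class of a derangement has at least \<open>n - 1\<close> elements.

  Conversely let all derangements be conjugate, and let \<open>N\<close> be a minimal normal subgroup. It is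
  transitive. If \<open>N\<close> is abelian, it is regular and its nontrivial elements are the derangements.
  So \<open>G\<close> acts transitively on them by conjugation, hence on the pairs of distinct points. For
  \<open>h \<notin> N\<close> the coset \<open>N h\<close> contains no derangement, while its elements have \<open>|N|\<close> fixed points in
  total; so each has exactly one.

  Suppose that \<open>N\<close> is nonabelian. Let \<open>T\<close> be minimal normal in \<open>N\<close> and \<open>C\<close> the centralizer of \<open>T\<close>
  in \<open>N\<close>. Then \<open>N = T \<times> C\<close>, every \<open>G\<close>-conjugate of \<open>T\<close> is \<open>T\<close> or lies in \<open>C\<close>, and \<open>T\<close> has
  trivial center. So \<open>T\<close> is not semiregular: otherwise its nontrivial elements would all be
  conjugate in \<open>G\<close>, hence of the same order, and \<open>T\<close> would be a \<open>p\<close>-group. In particular no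
  transitive group centralizes \<open>T\<close>. If \<open>C = 1\<close>, then \<open>N = T\<close> is simple, and since \<open>G\<close> is not almost
  simple, the centralizer of \<open>N\<close> in \<open>G\<close> is nontrivial and therefore transitive, a contradiction. If
  \<open>C \<noteq> 1\<close>, then \<open>C\<close> is intransitive, so by Jordan's theorem some \<open>t \<in> T\<close> moves every orbit of \<open>C\<close>.
  All elements of \<open>C t\<close> are then derangements, but \<open>t\<close> is not conjugate to \<open>c t\<close> for \<open>c \<noteq> 1\<close>.
\<close>

subsection \<open>Conjugation and centralizers\<close>

definition conjugate :: "('g, 'b) monoid_scheme \<Rightarrow> 'g \<Rightarrow> 'g \<Rightarrow> 'g" where
  "conjugate G g a = g \<otimes>\<^bsub>G\<^esub> a \<otimes>\<^bsub>G\<^esub> inv\<^bsub>G\<^esub> g"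

definition centralizer :: "('g, 'b) monoid_scheme \<Rightarrow> 'g set \<Rightarrow> 'g set" where
  "centralizer G A = {c \<in> carrier G. \<forall>a\<in>A. c \<otimes>\<^bsub>G\<^esub> a = a \<otimes>\<^bsub>G\<^esub> c}"

lemma conj_class_eq_image: "conj_class G a = (\<lambda>g. conjugate G g a) ` carrier G"
  by (auto simp: conj_class_def conjugate_def)

context group
begin

lemma conjugate_closed [simp]:
  "\<lbrakk>g \<in> carrier G; a \<in> carrier G\<rbrakk> \<Longrightarrow> conjugate G g a \<in> carrier G"
  by (simp add: conjugate_def)

lemma conjugate_one [simp]: "g \<in> carrier G \<Longrightarrow> conjugate G g \<one> = \<one>"
  by (simp add: conjugate_def)

lemma one_conjugate [simp]: "a \<in> carrier G \<Longrightarrow> conjugate G \<one> a = a"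
  by (simp add: conjugate_def)

lemma conjugate_conjugate:
  "\<lbrakk>g \<in> carrier G; h \<in> carrier G; a \<in> carrier G\<rbrakk>
    \<Longrightarrow> conjugate G g (conjugate G h a) = conjugate G (g \<otimes> h) a"
  by (simp add: conjugate_def m_assoc inv_mult_group)

lemma conjugate_inv_cancel [simp]:
  assumes "g \<in> carrier G" "a \<in> carrier G"
  shows "conjugate G (inv g) (conjugate G g a) = a" and "conjugate G g (conjugate G (inv g) a) = a"
  using assms by (simp_all add: conjugate_conjugate)

lemma conjugate_mult:
  assumes "g \<in> carrier G" "a \<in> carrier G" "b \<in> carrier G"
  shows "conjugate G g (a \<otimes> b) = conjugate G g a \<otimes> conjugate G g b"
proof -
  have "inv g \<otimes> (g \<otimes> (b \<otimes> inv g)) = b \<otimes> inv g"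
    using assms by (simp flip: m_assoc)
  then show ?thesis
    using assms by (simp add: conjugate_def m_assoc)
qed

lemma conjugate_hom: "g \<in> carrier G \<Longrightarrow> group_hom G G (conjugate G g)"
  by unfold_locales (auto simp: hom_def conjugate_mult)

lemma conjugate_eq_one_iff [simp]:
  assumes "g \<in> carrier G" "a \<in> carrier G"
  shows "conjugate G g a = \<one> \<longleftrightarrow> a = \<one>"
  using assms conjugate_inv_cancel(1) conjugate_one inv_closed by metis

lemma conjugate_eq_self_iff:
  assumes "g \<in> carrier G" "a \<in> carrier G"
  shows "conjugate G g a = a \<longleftrightarrow> g \<otimes> a = a \<otimes> g"
  using assms by (simp add: conjugate_def inv_solve_right')

lemma ord_conjugate:
  assumes g: "g \<in> carrier G" and a: "a \<in> carrier G"
  shows "ord (conjugate G g a) = ord a"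
proof -
  have "conjugate G g a [^] n = conjugate G g (a [^] n)" for n :: nat
    using group_hom.hom_nat_pow[OF conjugate_hom[OF g] a] by simp
  then show ?thesis
    using assms by (simp add: ord_unique pow_eq_id)
qed

lemma ord_subgroup:
  assumes "subgroup H G" "a \<in> H"
  shows "group.ord (G\<lparr>carrier := H\<rparr>) a = ord a"
proof -
  interpret H: group "G\<lparr>carrier := H\<rparr>"
    by (rule subgroup.subgroup_is_group[OF assms(1) is_group])
  show ?thesis
    using assms by (simp add: H.ord_unique pow_eq_id subgroup.mem_carrier flip: nat_pow_consistent)
qed

lemma conjugate_restrict:
  "\<lbrakk>subgroup H G; h \<in> H\<rbrakk> \<Longrightarrow> conjugate (G\<lparr>carrier := H\<rparr>) h a = conjugate G h a"
  by (simp add: conjugate_def)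

lemma centralizer_eq_fixes_conjugate:
  assumes "A \<subseteq> carrier G"
  shows "centralizer G A = {c \<in> carrier G. \<forall>a\<in>A. conjugate G c a = a}"
  using assms by (auto simp: centralizer_def conjugate_eq_self_iff subset_iff)

lemma conjugate_by_centralizer:
  "\<lbrakk>A \<subseteq> carrier G; c \<in> centralizer G A; a \<in> A\<rbrakk> \<Longrightarrow> conjugate G c a = a"
  by (simp add: centralizer_eq_fixes_conjugate)

lemma centralizer_restrict:
  "H \<subseteq> carrier G \<Longrightarrow> centralizer (G\<lparr>carrier := H\<rparr>) A = H \<inter> centralizer G A"
  by (auto simp: centralizer_def)

lemma subgroup_centralizer:
  assumes A: "A \<subseteq> carrier G"
  shows "subgroup (centralizer G A) G"
proof (rule subgroupI)
  show subset: "centralizer G A \<subseteq> carrier G" by (auto simp: centralizer_def)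
  have "\<one> \<in> centralizer G A" using A by (auto simp: centralizer_def subset_iff)
  then show "centralizer G A \<noteq> {}" by blast
  fix c assume c: "c \<in> centralizer G A"
  have "conjugate G (inv c) a = a" if a: "a \<in> A" for a
    using conjugate_by_centralizer[OF A c a] conjugate_inv_cancel(1)[of c a] a c A subset by force
  then show "inv c \<in> centralizer G A"
    using c subset by (auto simp: centralizer_eq_fixes_conjugate[OF A])
  fix d assume d: "d \<in> centralizer G A"
  have "conjugate G (c \<otimes> d) a = a" if a: "a \<in> A" for a
    using conjugate_by_centralizer[OF A c a] conjugate_by_centralizer[OF A d a]
      conjugate_conjugate[of c d a] a c d A subset by force
  then show "c \<otimes> d \<in> centralizer G A"
    using c d subset by (auto simp: centralizer_eq_fixes_conjugate[OF A])
qed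

lemma normal_iff_conjugate:
  "H \<lhd> G \<longleftrightarrow> subgroup H G \<and> (\<forall>g\<in>carrier G. \<forall>h\<in>H. conjugate G g h \<in> H)"
  by (simp add: normal_inv_iff conjugate_def)

lemma normal_centralizer:
  assumes K: "K \<lhd> G"
  shows "centralizer G K \<lhd> G"
proof -
  have K_sub: "K \<subseteq> carrier G"
    using K by (simp add: normal_imp_subgroup subgroup.subset)
  have "conjugate G g c \<in> centralizer G K" if g: "g \<in> carrier G" and c: "c \<in> centralizer G K" for g c
  proof -
    have "conjugate G g c \<otimes> k = k \<otimes> conjugate G g c" if k: "k \<in> K" for k
    proof -
      let ?k = "conjugate G (inv g) k"
      have "?k \<in> K" using K g k by (simp add: normal_iff_conjugate)
      then have "conjugate G g (c \<otimes> ?k) = conjugate G g (?k \<otimes> c)"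
        using c by (simp add: centralizer_def)
      then show ?thesis
        using g c k K_sub by (simp add: conjugate_mult centralizer_def subset_iff)
    qed
    then show ?thesis using g c by (simp add: centralizer_def)
  qed
  then show ?thesis
    using subgroup_centralizer[OF K_sub] by (simp add: normal_iff_conjugate)
qed

lemma normal_subgroup_iff:
  assumes K: "subgroup K G"
  shows "L \<lhd> G\<lparr>carrier := K\<rparr> \<longleftrightarrow>
    subgroup L G \<and> L \<subseteq> K \<and> (\<forall>k\<in>K. \<forall>l\<in>L. conjugate G k l \<in> L)"
proof -
  interpret K: group "G\<lparr>carrier := K\<rparr>"
    by (rule subgroup.subgroup_is_group[OF K is_group])
  have "subgroup L (G\<lparr>carrier := K\<rparr>) \<longleftrightarrow> subgroup L G \<and> L \<subseteq> K"
    using incl_subgroup[OF K] subgroup_incl[OF _ K] subgroup.subset[of L "G\<lparr>carrier := K\<rparr>"]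
    by fastforce
  then show ?thesis
    using K by (auto simp: K.normal_iff_conjugate conjugate_restrict)
qed

end

subsection \<open>Finite \<open>p\<close>-groups\<close>

lemma (in group) exists_ord_prime:
  assumes fin: "finite (carrier G)" and p: "Factorial_Ring.prime (p::nat)" "p dvd order G"
  shows "\<exists>a\<in>carrier G. ord a = p"
proof -
  obtain m where "order G = p ^ 1 * m" using p(2) by (auto elim: dvdE)
  then obtain H where H: "subgroup H G" "card H = p"
    using sylow_thm[OF p(1) is_group _ fin, of 1] by auto
  interpret H: subgroup H G by (rule H)
  interpret HG: group "G\<lparr>carrier := H\<rparr>" by (rule H.subgroup_is_group[OF is_group])
  have "H \<noteq> {\<one>}" using H(2) p(1) by auto
  then obtain a where a: "a \<in> H" "a \<noteq> \<one>" using H.one_closed by blast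
  have "ord a dvd p"
    using HG.ord_dvd_group_order[of a] a H by (simp add: ord_subgroup order_def)
  moreover have "ord a \<noteq> 1" using a ord_eq_1 by auto
  ultimately show ?thesis using p(1) a by (auto simp: prime_nat_iff)
qed

lemma (in group) order_prime_power_if_ord_constant:
  assumes fin: "finite (carrier G)" and nontrivial: "carrier G \<noteq> {\<one>}"
    and ord_eq: "\<And>a b. \<lbrakk>a \<in> carrier G; b \<in> carrier G; a \<noteq> \<one>; b \<noteq> \<one>\<rbrakk> \<Longrightarrow> ord a = ord b"
  shows "\<exists>p n. Factorial_Ring.prime (p::nat) \<and> order G = p ^ n"
proof -
  have order_pos: "order G \<noteq> 0" using fin by (auto simp: order_def)
  have "order G \<noteq> 1" using nontrivial order_one_triv_iff by blast
  then obtain p where p: "Factorial_Ring.prime p" "p dvd order G" using prime_factor_nat by blast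
  have unique: "q = p" if q: "Factorial_Ring.prime q" "q dvd order G" for q
  proof -
    obtain a b where "a \<in> carrier G" "ord a = p" "b \<in> carrier G" "ord b = q"
      using exists_ord_prime[OF fin] p q by metis
    moreover from this have "a \<noteq> \<one>" "b \<noteq> \<one>" using p q by auto
    ultimately show ?thesis using ord_eq by metis
  qed
  have "prime_factors (order G) = {p}"
    unfolding prime_factors_dvd[OF order_pos] using p unique by blast
  then have "order G = p ^ multiplicity p (order G)"
    using prod_prime_factors[of "order G"] order_pos by simp
  then show ?thesis using p(1) by blast
qed

sublocale group_action \<subseteq> group
  using group_hom group_hom.axioms(1) by blast

lemma (in group_action) card_fixed_points_mod_prime:
  assumes fin: "finite E" and p: "Factorial_Ring.prime (p::nat)" "order G = p ^ n"
  shows "card {x \<in> E. \<forall>g\<in>carrier G. \<phi> g x = x} mod p = card E mod p"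
proof -
  let ?F = "{x \<in> E. \<forall>g\<in>carrier G. \<phi> g x = x}" and ?O = "orbits G E \<phi>"
  have orbit_fixed: "orbit G \<phi> x = {x}" if "x \<in> ?F" for x
    using that orbit_refl[of x] by (auto simp: orbit_def)
  then have singletons: "(\<lambda>x. {x}) ` ?F \<subseteq> ?O" by (force simp: orbits_def)
  have "p dvd card C" if C: "C \<in> ?O - (\<lambda>x. {x}) ` ?F" for C
  proof -
    obtain x where x: "x \<in> E" "C = orbit G \<phi> x" using C by (auto simp: orbits_def)
    have "card C dvd p ^ n"
      using orbit_stabilizer_theorem[OF x(1)] unfolding x(2) p(2) by (rule dvdI[OF sym])
    moreover have "card C \<noteq> 1"
    proof
      assume "card C = 1"
      then have "C = {x}" using orbit_refl[OF x(1)] x(2) by (metis card_1_singletonE singletonD)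
      then have "x \<in> ?F" using x by (auto simp: orbit_def)
      then show False using C \<open>C = {x}\<close> by blast
    qed
    ultimately obtain i where "card C = p ^ i" "i \<noteq> 0"
      using p(1) by (auto simp: divides_primepow_nat)
    then show ?thesis by simp
  qed
  then have "p dvd (\<Sum>C\<in>?O - (\<lambda>x. {x}) ` ?F. card C)" by (rule dvd_sum)
  moreover have "card E = (\<Sum>C\<in>?O - (\<lambda>x. {x}) ` ?F. card C) + card ?F"
  proof -
    have "finite ?O" using fin by (simp add: orbits_def)
    have "card E = (\<Sum>C\<in>?O. card C)"
      using disjoint_sum[OF fin, of "\<lambda>_. 1::nat"] by simp
    also have "\<dots> = (\<Sum>C\<in>?O - (\<lambda>x. {x}) ` ?F. card C) + (\<Sum>C\<in>(\<lambda>x. {x}) ` ?F. card C)"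
      using singletons \<open>finite ?O\<close> by (rule sum.subset_diff)
    also have "(\<Sum>C\<in>(\<lambda>x. {x}) ` ?F. card C) = card ?F"
      by (subst sum.reindex) auto
    finally show ?thesis .
  qed
  ultimately show ?thesis by (auto elim!: dvdE)
qed

lemma (in group) center_nontrivial_if_prime_power_order:
  assumes fin: "finite (carrier G)" and nontrivial: "carrier G \<noteq> {\<one>}"
    and p: "Factorial_Ring.prime (p::nat)" "order G = p ^ n"
  shows "centralizer G (carrier G) \<noteq> {\<one>}"
proof -
  interpret conjugation: group_action G "carrier G" "\<lambda>g. \<lambda>a\<in>carrier G. g \<otimes> a \<otimes> inv g"
    by (rule action_by_conjugation)
  have "{a \<in> carrier G. \<forall>g\<in>carrier G. (\<lambda>a\<in>carrier G. g \<otimes> a \<otimes> inv g) a = a}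
      = centralizer G (carrier G)"
    by (auto simp: centralizer_def conjugate_eq_self_iff simp flip: conjugate_def)
  then have "card (centralizer G (carrier G)) mod p = order G mod p"
    using conjugation.card_fixed_points_mod_prime[OF fin p] by (simp add: order_def)
  moreover have "order G \<noteq> 1" using nontrivial order_one_triv_iff by blast
  then have "p dvd order G" using p by (cases n) auto
  ultimately have "p dvd card (centralizer G (carrier G))" by (simp add: dvd_eq_mod_eq_0)
  then show ?thesis using p(1) by auto
qed

subsection \<open>Minimal normal subgroups\<close>

definition minimal_normal :: "('g, 'b) monoid_scheme \<Rightarrow> 'g set \<Rightarrow> bool" where
  "minimal_normal G H \<longleftrightarrow> H \<lhd> G \<and> H \<noteq> {\<one>\<^bsub>G\<^esub>} \<and>
     (\<forall>L. L \<lhd> G \<longrightarrow> L \<subseteq> H \<longrightarrow> L \<noteq> {\<one>\<^bsub>G\<^esub>} \<longrightarrow> L = H)"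

context group
begin

lemma minimal_normal_exists:
  assumes fin: "finite (carrier G)" and nontrivial: "carrier G \<noteq> {\<one>}"
  obtains H where "minimal_normal G H"
proof -
  let ?P = "\<lambda>H. H \<lhd> G \<and> H \<noteq> {\<one>}"
  have "?P (carrier G)" using nontrivial by (auto simp: normal_iff_conjugate subgroup_self)
  then obtain H where H: "?P H" and least: "\<And>L. ?P L \<Longrightarrow> card H \<le> card L"
    using ex_has_least_nat[where P = ?P and m = card] by metis
  have "finite H" using H fin by (meson finite_subset normal_imp_subgroup subgroup.subset)
  then have "minimal_normal G H"
    using H least card_seteq by (auto simp: minimal_normal_def)
  then show ?thesis using that by blast
qed

lemma minimal_normal_Int_cases:
  assumes H: "minimal_normal G H" and L: "L \<lhd> G"
  shows "H \<inter> L = {\<one>} \<or> H \<subseteq> L"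
  using H normal_subgroup_intersect[of H L] L unfolding minimal_normal_def by blast

lemma simple_group_if_minimal_normal_carrier:
  assumes fin: "finite (carrier G)" and min: "minimal_normal G (carrier G)"
  shows "simple_group G"
proof
  have "order G \<noteq> 1" using min order_one_triv_iff by (auto simp: minimal_normal_def)
  moreover have "order G \<noteq> 0" using fin by (auto simp: order_def)
  ultimately show "1 < order G" by simp
  fix H assume H: "H \<lhd> G"
  then have "H \<subseteq> carrier G" by (simp add: normal_imp_subgroup subgroup.subset)
  then show "H = carrier G \<or> H = {\<one>}" using min H unfolding minimal_normal_def by blast
qed

lemma comm_group_subgroup_iff:
  assumes H: "subgroup H G"
  shows "comm_group (G\<lparr>carrier := H\<rparr>) \<longleftrightarrow> H \<subseteq> centralizer G H"
proof
  interpret H: group "G\<lparr>carrier := H\<rparr>" by (rule subgroup.subgroup_is_group[OF H is_group])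
  assume "H \<subseteq> centralizer G H"
  then show "comm_group (G\<lparr>carrier := H\<rparr>)"
    by (intro H.group_comm_groupI) (auto simp: centralizer_def)
next
  assume "comm_group (G\<lparr>carrier := H\<rparr>)"
  then interpret H: comm_group "G\<lparr>carrier := H\<rparr>" .
  show "H \<subseteq> centralizer G H"
    using H.m_comm subgroup.subset[OF H] by (auto simp: centralizer_def)
qed

lemma conjugate_image_cancel:
  assumes "g \<in> carrier G" "A \<subseteq> carrier G"
  shows "conjugate G (inv g) ` conjugate G g ` A = A" and "conjugate G g ` conjugate G (inv g) ` A = A"
  using assms by (simp_all add: image_image subset_iff cong: image_cong_simp)

lemma normal_conjugate_image:
  assumes N: "N \<lhd> G" and g: "g \<in> carrier G" and L: "L \<lhd> G\<lparr>carrier := N\<rparr>"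
  shows "conjugate G g ` L \<lhd> G\<lparr>carrier := N\<rparr>"
proof -
  have N_sub: "subgroup N G" using N by (rule normal_imp_subgroup)
  note L_normal = L[unfolded normal_subgroup_iff[OF N_sub]]
  interpret N: subgroup N G by (rule N_sub)
  have "conjugate G n (conjugate G g l) \<in> conjugate G g ` L" if n: "n \<in> N" and l: "l \<in> L" for n l
  proof -
    let ?n = "conjugate G (inv g) n"
    have car: "n \<in> carrier G" "l \<in> carrier G" using n l L_normal by auto
    have "g \<otimes> ?n = n \<otimes> g"
      using g car by (simp add: conjugate_def flip: m_assoc)
    then have "conjugate G g (conjugate G ?n l) = conjugate G n (conjugate G g l)"
      using g car by (simp add: conjugate_conjugate)
    moreover have "conjugate G ?n l \<in> L"
      using N g n l L_normal by (simp add: normal_iff_conjugate)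
    ultimately show ?thesis by (metis imageI)
  qed
  moreover have "subgroup (conjugate G g ` L) G"
    using group_hom.subgroup_img_is_subgroup[OF conjugate_hom[OF g]] L_normal by blast
  moreover have "conjugate G g ` L \<subseteq> N"
    using N g L_normal by (auto simp: normal_iff_conjugate)
  ultimately show ?thesis unfolding normal_subgroup_iff[OF N_sub] by blast
qed

lemma minimal_normal_conjugate_image:
  assumes N: "N \<lhd> G" and g: "g \<in> carrier G" and T: "minimal_normal (G\<lparr>carrier := N\<rparr>) T"
  shows "minimal_normal (G\<lparr>carrier := N\<rparr>) (conjugate G g ` T)"
proof -
  have carrier: "L \<subseteq> carrier G" if "L \<lhd> G\<lparr>carrier := N\<rparr>" for L
    using that N by (simp add: normal_subgroup_iff normal_imp_subgroup subgroup.subset)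
  have trivial: "L = {\<one>}" if "conjugate G h ` L = {\<one>}" "h \<in> carrier G" "L \<subseteq> carrier G" for h L
    using conjugate_image_cancel(1)[of h L] that by simp
  show ?thesis
    unfolding minimal_normal_def
  proof (intro conjI allI impI)
    show "conjugate G g ` T \<lhd> G\<lparr>carrier := N\<rparr>"
      using N g T by (simp add: minimal_normal_def normal_conjugate_image)
    show "conjugate G g ` T \<noteq> {\<one>\<^bsub>G\<lparr>carrier := N\<rparr>\<^esub>}"
      using T trivial[OF _ g carrier[of T]] by (auto simp: minimal_normal_def)
    fix L
    assume L: "L \<lhd> G\<lparr>carrier := N\<rparr>" "L \<subseteq> conjugate G g ` T" "L \<noteq> {\<one>\<^bsub>G\<lparr>carrier := N\<rparr>\<^esub>}"
    let ?L = "conjugate G (inv g) ` L"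
    have "?L \<lhd> G\<lparr>carrier := N\<rparr>" using N g L by (simp add: normal_conjugate_image)
    moreover have "?L \<subseteq> T"
      using image_mono[OF L(2), of "conjugate G (inv g)"] conjugate_image_cancel(1)[OF g] T carrier
      by (simp add: minimal_normal_def)
    moreover have "?L \<noteq> {\<one>}" using L(3) trivial[OF _ inv_closed[OF g] carrier[OF L(1)]] by auto
    ultimately have "?L = T" using T by (simp add: minimal_normal_def)
    then show "L = conjugate G g ` T" using conjugate_image_cancel(2)[OF g carrier[OF L(1)]] by simp
  qed
qed

lemma conjugate_minimal_normal_cases:
  assumes N: "N \<lhd> G" and T: "minimal_normal (G\<lparr>carrier := N\<rparr>) T" and g: "g \<in> carrier G"
  shows "conjugate G g ` T = T \<or> conjugate G g ` T \<subseteq> N \<inter> centralizer G T"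
proof -
  interpret N: normal N G by (rule N)
  interpret NG: group "G\<lparr>carrier := N\<rparr>" by (rule N.subgroup_is_group[OF is_group])
  let ?S = "conjugate G g ` T"
  have S: "minimal_normal (G\<lparr>carrier := N\<rparr>) ?S"
    using N g T by (rule minimal_normal_conjugate_image)
  have normal: "T \<lhd> G\<lparr>carrier := N\<rparr>" "?S \<lhd> G\<lparr>carrier := N\<rparr>"
    using T S by (simp_all add: minimal_normal_def)
  from NG.minimal_normal_Int_cases[OF T normal(2)] show ?thesis
  proof
    assume "T \<subseteq> ?S"
    then show ?thesis using T S normal unfolding minimal_normal_def by blast
  next
    assume disjoint: "T \<inter> ?S = {\<one>\<^bsub>G\<lparr>carrier := N\<rparr>\<^esub>}"
    have "?S \<subseteq> N" using normal(2) by (simp add: normal_subgroup_iff N.subgroup_axioms)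
    moreover have "s \<otimes> t = t \<otimes> s" if "s \<in> ?S" "t \<in> T" for s t
      using NG.normal_imp_commuting[OF normal, of t s] disjoint that by simp
    ultimately show ?thesis using N.subset unfolding centralizer_def by blast
  qed
qed

lemma generate_conjugates_eq_minimal_normal:
  assumes N: "minimal_normal G N" and A: "A \<subseteq> N" "\<not> A \<subseteq> {\<one>}"
  shows "generate G (\<Union>g\<in>carrier G. conjugate G g ` A) = N" (is "generate G ?U = N")
proof -
  interpret N: normal N G using N by (simp add: minimal_normal_def)
  have A_carrier: "A \<subseteq> carrier G" using A(1) N.subset by blast
  then have U: "?U \<subseteq> carrier G" by auto
  have "generate G ?U \<lhd> G"
  proof (rule normal_generateI[OF U])
    fix u g assume "u \<in> ?U" and g: "g \<in> carrier G"
    then obtain k a where k: "k \<in> carrier G" "a \<in> A" "u = conjugate G k a" by blast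
    then have "conjugate G g u = conjugate G (g \<otimes> k) a"
      using g A_carrier by (auto simp: conjugate_conjugate)
    then show "g \<otimes> u \<otimes> inv g \<in> ?U" using g k unfolding conjugate_def[symmetric] by blast
  qed
  moreover have "?U \<subseteq> N" using N.normal_axioms A(1) by (auto simp: normal_iff_conjugate)
  then have "generate G ?U \<subseteq> N" using N.subgroup_axioms by (rule generate_subgroup_incl)
  moreover have "A \<subseteq> ?U" using A_carrier by (intro subsetI UN_I[of \<one>] image_eqI) auto
  then have "A \<subseteq> generate G ?U" by (blast intro: generate.incl)
  then have "generate G ?U \<noteq> {\<one>}" using A(2) by metis
  ultimately show ?thesis using N by (simp add: minimal_normal_def)
qed

lemma minimal_normal_eq_product:
  assumes N: "minimal_normal G N" and T: "minimal_normal (G\<lparr>carrier := N\<rparr>) T"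
  shows "T <#> (N \<inter> centralizer G T) = N"
proof
  interpret N: normal N G using N by (simp add: minimal_normal_def)
  interpret NG: group "G\<lparr>carrier := N\<rparr>" by (rule N.subgroup_is_group[OF is_group])
  interpret T: normal T "G\<lparr>carrier := N\<rparr>" using T by (simp add: minimal_normal_def)
  let ?C = "N \<inter> centralizer G T"
  have C_subgroup: "subgroup ?C (G\<lparr>carrier := N\<rparr>)"
    using NG.subgroup_centralizer[OF T.subset] by (simp add: centralizer_restrict N.subset)
  interpret second_isomorphism_grp T "G\<lparr>carrier := N\<rparr>" ?C
    using T.normal_axioms C_subgroup
    by (intro second_isomorphism_grp.intro second_isomorphism_grp_axioms.intro)
  have TC_eq: "T <#>\<^bsub>G\<lparr>carrier := N\<rparr>\<^esub> ?C = T <#> ?C"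
    by (simp add: set_mult_def)
  show "T <#> ?C \<subseteq> N"
    using subgroup.subset[OF normal_set_mult_subgroup] by (simp add: TC_eq)
  have "(\<Union>g\<in>carrier G. conjugate G g ` T) \<subseteq> T <#> ?C"
    using conjugate_minimal_normal_cases[OF N.normal_axioms T] H_contained_in_set_mult
      S_contained_in_set_mult unfolding TC_eq by blast
  moreover have "subgroup (T <#> ?C) G"
    using incl_subgroup[OF N.subgroup_axioms normal_set_mult_subgroup] by (simp add: TC_eq)
  ultimately have "generate G (\<Union>g\<in>carrier G. conjugate G g ` T) \<subseteq> T <#> ?C"
    by (rule generate_subgroup_incl)
  moreover have "T \<subseteq> N" "\<not> T \<subseteq> {\<one>}"
    using T T.subset T.one_closed by (auto simp: minimal_normal_def)
  ultimately show "N \<subseteq> T <#> ?C"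
    using generate_conjugates_eq_minimal_normal[OF N] by simp
qed

lemma minimal_normal_centerless:
  assumes N: "minimal_normal G N" and T: "minimal_normal (G\<lparr>carrier := N\<rparr>) T"
    and nonabelian: "\<not> N \<subseteq> centralizer G N"
  shows "T \<inter> centralizer G T = {\<one>}"
proof (rule ccontr)
  assume nontrivial: "\<not> ?thesis"
  interpret N: normal N G using N by (simp add: minimal_normal_def)
  interpret NG: group "G\<lparr>carrier := N\<rparr>" by (rule N.subgroup_is_group[OF is_group])
  have T_normal: "T \<lhd> G\<lparr>carrier := N\<rparr>" "T \<noteq> {\<one>}" using T by (simp_all add: minimal_normal_def)
  have T_N: "subgroup T G" "T \<subseteq> N"
    using T_normal by (simp_all add: normal_subgroup_iff N.subgroup_axioms)
  have "T \<inter> centralizer G T \<noteq> {\<one>} \<and> T \<inter> (N \<inter> centralizer G T) = T \<inter> centralizer G T"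
    using nontrivial T_N by blast
  then have abelian: "T \<subseteq> centralizer G T"
    using NG.minimal_normal_Int_cases[OF T NG.normal_centralizer[OF T_normal(1)]]
    by (simp add: centralizer_restrict N.subset)
  have "t \<in> centralizer G N" if t: "t \<in> T" for t
  proof -
    have "t \<otimes> n = n \<otimes> t" if n: "n \<in> N" for n
    proof -
      obtain s c where n_eq: "n = s \<otimes> c" and s: "s \<in> T" and c: "c \<in> N \<inter> centralizer G T"
        using n minimal_normal_eq_product[OF N T] unfolding set_mult_def by blast
      have "conjugate G s t = t" "conjugate G c t = t"
        using abelian s c t subgroup.subset[OF T_N(1)] by (auto intro: conjugate_by_centralizer)
      moreover have "s \<in> carrier G" "c \<in> carrier G" "t \<in> carrier G"
        using s c t T_N N.subset by auto
      ultimately have "conjugate G n t = t"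
        unfolding n_eq by (simp flip: conjugate_conjugate)
      then show ?thesis using n t T_N by (simp add: conjugate_eq_self_iff subset_iff)
    qed
    then show ?thesis using t T_N by (simp add: centralizer_def subset_iff)
  qed
  then have "T \<subseteq> N \<inter> centralizer G N" using T_N by blast
  then have "N \<inter> centralizer G N \<noteq> {\<one>}"
    using T_normal(2) subgroup.one_closed[OF T_N(1)] by blast
  then have "N \<subseteq> centralizer G N"
    using minimal_normal_Int_cases[OF N normal_centralizer[OF N.normal_axioms]] by blast
  then show False using nonabelian by blast
qed

lemma almost_simple_if_nonabelian_simple_normal:
  assumes fin: "finite (carrier G)" and N: "N \<lhd> G" "minimal_normal (G\<lparr>carrier := N\<rparr>) N"
    and nonabelian: "\<not> N \<subseteq> centralizer G N" and centralizer: "centralizer G N = {\<one>}"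
  shows "almost_simple G"
  unfolding almost_simple_def
proof (intro exI conjI ballI impI)
  interpret N: normal N G by (rule N(1))
  interpret NG: group "G\<lparr>carrier := N\<rparr>" by (rule N.subgroup_is_group[OF is_group])
  show "N \<lhd> G" by (rule N(1))
  show "simple_group (G\<lparr>carrier := N\<rparr>)"
    using N(2) finite_subset[OF N.subset fin] by (intro NG.simple_group_if_minimal_normal_carrier) auto
  show "\<not> comm_group (G\<lparr>carrier := N\<rparr>)"
    using nonabelian by (simp add: comm_group_subgroup_iff N.subgroup_axioms)
  show "g = \<one>" if "g \<in> carrier G" "\<forall>n\<in>N. g \<otimes> n = n \<otimes> g" for g
    using that centralizer unfolding centralizer_def by blast
qed

end

subsection \<open>Derangements\<close>

definition derangements :: "[_, 'b set, 'a \<Rightarrow> 'b \<Rightarrow> 'b] \<Rightarrow> 'a set" where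
  "derangements G E \<phi> = {g \<in> carrier G. invariants E \<phi> g = {}}"

definition semiregular :: "[_, 'b set, 'a \<Rightarrow> 'b \<Rightarrow> 'b] \<Rightarrow> bool" where
  "semiregular G E \<phi> \<longleftrightarrow> (\<forall>g\<in>carrier G. \<forall>x\<in>E. \<phi> g x = x \<longrightarrow> g = \<one>\<^bsub>G\<^esub>)"

lemma mem_derangements_iff:
  "g \<in> derangements G E \<phi> \<longleftrightarrow> g \<in> carrier G \<and> (\<forall>x\<in>E. \<phi> g x \<noteq> x)"
  by (auto simp: derangements_def invariants_def)

lemma group_actionI:
  fixes G (structure)
  assumes "group G"
    and extensional: "\<And>g. g \<in> carrier G \<Longrightarrow> \<phi> g \<in> extensional E"
    and closed: "\<And>g x. \<lbrakk>g \<in> carrier G; x \<in> E\<rbrakk> \<Longrightarrow> \<phi> g x \<in> E"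
    and one: "\<And>x. x \<in> E \<Longrightarrow> \<phi> \<one> x = x"
    and mult: "\<And>g h x. \<lbrakk>g \<in> carrier G; h \<in> carrier G; x \<in> E\<rbrakk> \<Longrightarrow> \<phi> (g \<otimes> h) x = \<phi> g (\<phi> h x)"
  shows "group_action G E \<phi>"
proof -
  interpret group G by fact
  have "bij_betw (\<phi> g) E E" if "g \<in> carrier G" for g
    using that closed one by (intro bij_betwI[where g = "\<phi> (inv g)"]) (auto simp flip: mult)
  then have bij: "\<phi> g \<in> Bij E" if "g \<in> carrier G" for g
    using that extensional by (simp add: Bij_def)
  have "\<phi> (g \<otimes> h) = compose E (\<phi> g) (\<phi> h)" if "g \<in> carrier G" "h \<in> carrier G" for g h
    using that extensional mult by (intro extensionalityI[of _ E]) (auto simp: compose_def)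
  then have "\<phi> \<in> hom G (BijGroup E)"
    using bij by (auto simp: hom_def BijGroup_def)
  then show ?thesis
    unfolding group_action_def group_hom_def group_hom_axioms_def
    using group_BijGroup is_group by blast
qed

context group_action
begin

lemma act_closed [simp]: "\<lbrakk>g \<in> carrier G; x \<in> E\<rbrakk> \<Longrightarrow> \<phi> g x \<in> E"
  using element_image by blast

lemma act_one [simp]: "x \<in> E \<Longrightarrow> \<phi> \<one> x = x"
  by (metis id_eq_one restrict_apply')

lemma act_eq_iff [simp]:
  "\<lbrakk>g \<in> carrier G; x \<in> E; y \<in> E\<rbrakk> \<Longrightarrow> \<phi> g x = \<phi> g y \<longleftrightarrow> x = y"
  using inj_prop by (auto simp: inj_on_def)

lemma act_inv [simp]: "\<lbrakk>g \<in> carrier G; x \<in> E\<rbrakk> \<Longrightarrow> \<phi> (inv g) (\<phi> g x) = x"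
  using orbit_sym_aux by blast

lemma invariants_one [simp]: "invariants E \<phi> \<one> = E"
  by (auto simp: invariants_def)

lemma act_conjugate:
  assumes "g \<in> carrier G" "a \<in> carrier G" "x \<in> E"
  shows "\<phi> (conjugate G g a) (\<phi> g x) = \<phi> g (\<phi> a x)"
  using assms by (simp add: conjugate_def composition_rule)

lemma orbit_eq_if_mem:
  assumes x: "x \<in> E" and y: "y \<in> orbit G \<phi> x"
  shows "orbit G \<phi> y = orbit G \<phi> x"
proof -
  have "y \<in> E" using x y by (auto simp: orbit_def)
  then show ?thesis
    using disjoint_union[of "orbit G \<phi> x" "orbit G \<phi> y"] x y orbit_refl[of y]
    by (auto simp: orbits_def)
qed

lemma transitive_action_iff_orbit:
  "transitive_action G E \<phi> \<longleftrightarrow> (\<forall>x\<in>E. \<forall>y\<in>E. y \<in> orbit G \<phi> x)"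
  using group_action_axioms
  by (fastforce simp: transitive_action_def transitive_action_axioms_def orbit_def)

lemma conj_class_subset_derangements:
  assumes d: "d \<in> derangements G E \<phi>"
  shows "conj_class G d \<subseteq> derangements G E \<phi>"
proof
  fix a assume "a \<in> conj_class G d"
  then obtain g where g: "g \<in> carrier G" "a = conjugate G g d"
    by (auto simp: conj_class_eq_image)
  have d_carrier: "d \<in> carrier G" using d by (simp add: mem_derangements_iff)
  have "\<phi> a x \<noteq> x" if x: "x \<in> E" for x
  proof -
    obtain y where "y \<in> E" "x = \<phi> g y" using bij_prop1[OF g(1) x] by metis
    then show ?thesis using d d_carrier g by (simp add: act_conjugate mem_derangements_iff)
  qed
  then show "a \<in> derangements G E \<phi>" using g d_carrier by (simp add: mem_derangements_iff)
qed

lemma normal_orbit_image: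
  assumes K: "K \<lhd> G" and g: "g \<in> carrier G" and x: "x \<in> E"
  shows "\<phi> g ` orbit (G\<lparr>carrier := K\<rparr>) \<phi> x = orbit (G\<lparr>carrier := K\<rparr>) \<phi> (\<phi> g x)"
proof -
  interpret K: normal K G by (rule K)
  have conj_K: "conjugate G h k \<in> K" if "h \<in> carrier G" "k \<in> K" for h k
    using K that by (simp add: normal_iff_conjugate)
  have push: "\<phi> g (\<phi> k x) = \<phi> (conjugate G g k) (\<phi> g x)" if "k \<in> K" for k
    using that g x by (simp add: act_conjugate)
  have pull: "\<phi> k (\<phi> g x) = \<phi> g (\<phi> (conjugate G (inv g) k) x)" if "k \<in> K" for k
    using that g x act_conjugate[of g "conjugate G (inv g) k" x] by simp
  have orbit_K: "orbit (G\<lparr>carrier := K\<rparr>) \<phi> z = (\<lambda>k. \<phi> k z) ` K" for z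
    by (auto simp: orbit_def)
  show ?thesis
    unfolding orbit_K
  proof
    show "\<phi> g ` (\<lambda>k. \<phi> k x) ` K \<subseteq> (\<lambda>k. \<phi> k (\<phi> g x)) ` K"
      using conj_K[OF g] by (auto simp: push)
    show "(\<lambda>k. \<phi> k (\<phi> g x)) ` K \<subseteq> \<phi> g ` (\<lambda>k. \<phi> k x) ` K"
      using conj_K[OF inv_closed[OF g]] by (auto simp: pull)
  qed
qed

lemma normal_orbits_action:
  assumes K: "K \<lhd> G"
  shows "group_action G (orbits (G\<lparr>carrier := K\<rparr>) E \<phi>)
    (\<lambda>g. \<lambda>B\<in>orbits (G\<lparr>carrier := K\<rparr>) E \<phi>. \<phi> g ` B)"
    (is "group_action G ?O ?\<psi>")
proof (rule group_actionI)
  interpret K: group_action "G\<lparr>carrier := K\<rparr>" E \<phi>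
    using K by (intro induced_action normal_imp_subgroup)
  have subset: "B \<subseteq> E" if "B \<in> ?O" for B using that K.orbits_coverture by blast
  show closed: "?\<psi> g B \<in> ?O" if "g \<in> carrier G" "B \<in> ?O" for g B
    using that K by (auto simp: orbits_def normal_orbit_image) (metis act_closed)
  show "?\<psi> \<one> B = B" if "B \<in> ?O" for B
    using that subset[OF that] by (simp add: subset_iff cong: image_cong_simp)
  show "?\<psi> (g \<otimes> h) B = ?\<psi> g (?\<psi> h B)"
    if "g \<in> carrier G" "h \<in> carrier G" "B \<in> ?O" for g h B
  proof -
    have "\<phi> h ` B \<in> ?O" using closed[OF that(2,3)] that by simp
    then show ?thesis
      using that subset[OF that(3)]
      by (simp add: image_image composition_rule subset_iff cong: image_cong_simp)
  qed
qed (simp_all add: is_group)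

lemma semiregular_diff_one_subset_derangements:
  assumes "subgroup T G" "semiregular (G\<lparr>carrier := T\<rparr>) E \<phi>"
  shows "T - {\<one>} \<subseteq> derangements G E \<phi>"
  using assms by (auto simp: semiregular_def mem_derangements_iff subgroup.mem_carrier)

lemma semiregular_inj_on:
  assumes "semiregular G E \<phi>" "x \<in> E"
  shows "inj_on (\<lambda>g. \<phi> g x) (carrier G)"
proof (rule inj_onI)
  fix g h assume gh: "g \<in> carrier G" "h \<in> carrier G" "\<phi> g x = \<phi> h x"
  then have "\<phi> (inv h \<otimes> g) x = x" using assms(2) by (simp add: composition_rule)
  then have "inv h \<otimes> g = \<one>"
    using assms gh unfolding semiregular_def by (meson inv_closed m_closed)
  then show "g = h" using gh by (metis inv_closed inv_equality inv_inv)
qed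

end

lemma (in transitive_action) sum_card_invariants:
  assumes "finite (carrier G)" "finite E" "E \<noteq> {}"
  shows "(\<Sum>g\<in>carrier G. card (invariants E \<phi> g)) = order G"
  using burnside[OF assms(1,2)] one_orbit[OF assms(3)] by simp

lemma (in transitive_action) exists_derangement:
  assumes fin: "finite (carrier G)" "finite E" and xy: "x \<in> E" "y \<in> E" "x \<noteq> y"
  shows "derangements G E \<phi> \<noteq> {}"
proof
  assume "derangements G E \<phi> = {}"
  then have "invariants E \<phi> g \<noteq> {}" if "g \<in> carrier G" for g
    using that by (auto simp: derangements_def)
  moreover have "finite (invariants E \<phi> g)" for g using fin(2) by (simp add: invariants_def)
  ultimately have "1 \<le> card (invariants E \<phi> g)" if "g \<in> carrier G" for g
    using that by (simp add: Suc_le_eq card_gt_0_iff)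
  moreover have "E \<noteq> {}" using xy by blast
  then have "(\<Sum>g\<in>carrier G. 1) = (\<Sum>g\<in>carrier G. card (invariants E \<phi> g))"
    using sum_card_invariants[OF fin] by (simp add: order_def)
  ultimately have "1 = card (invariants E \<phi> \<one>)"
    using fin(1) by (intro sum_mono_inv[of "\<lambda>_. 1" "carrier G"]) auto
  then show False using xy by (metis invariants_one card_1_singletonE singletonD)
qed

lemma (in transitive_action) normal_orbits_transitive_action:
  assumes K: "K \<lhd> G"
  shows "transitive_action G (orbits (G\<lparr>carrier := K\<rparr>) E \<phi>)
    (\<lambda>g. \<lambda>B\<in>orbits (G\<lparr>carrier := K\<rparr>) E \<phi>. \<phi> g ` B)"
proof (intro transitive_action.intro transitive_action_axioms.intro normal_orbits_action[OF K])
  fix B C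
  assume B: "B \<in> orbits (G\<lparr>carrier := K\<rparr>) E \<phi>" and C: "C \<in> orbits (G\<lparr>carrier := K\<rparr>) E \<phi>"
  obtain x y where xy: "x \<in> E" "y \<in> E"
      "B = orbit (G\<lparr>carrier := K\<rparr>) \<phi> x" "C = orbit (G\<lparr>carrier := K\<rparr>) \<phi> y"
    using B C by (auto simp: orbits_def)
  obtain g where "g \<in> carrier G" "\<phi> g x = y" using unique_orbit xy by blast
  then show "\<exists>g\<in>carrier G. (\<lambda>B\<in>orbits (G\<lparr>carrier := K\<rparr>) E \<phi>. \<phi> g ` B) B = C"
    using B xy normal_orbit_image[OF K] by auto
qed

text \<open>Some \<open>g\<close> moves every orbit of \<open>K\<close>. All elements of \<open>K g\<close> map these orbits as \<open>g\<close> does.\<close>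

lemma (in transitive_action) exists_coset_of_derangements:
  assumes fin: "finite (carrier G)" "finite E"
    and K: "K \<lhd> G" and intransitive: "\<not> transitive_action (G\<lparr>carrier := K\<rparr>) E \<phi>"
  obtains g where "g \<in> carrier G" "K #> g \<subseteq> derangements G E \<phi>"
proof -
  interpret K: normal K G by (rule K)
  interpret KA: group_action "G\<lparr>carrier := K\<rparr>" E \<phi>
    by (rule induced_action[OF K.subgroup_axioms])
  let ?orbit = "orbit (G\<lparr>carrier := K\<rparr>) \<phi>" and ?O = "orbits (G\<lparr>carrier := K\<rparr>) E \<phi>"
  have orbits: "?orbit x \<in> ?O" if "x \<in> E" for x using that by (auto simp: orbits_def)
  have finite_orbits: "finite ?O" using fin(2) by (simp add: orbits_def)
  obtain x y where xy: "x \<in> E" "y \<in> E" "?orbit x \<noteq> ?orbit y"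
    using intransitive KA.orbit_refl unfolding KA.transitive_action_iff_orbit by metis
  then obtain g where g: "g \<in> derangements G ?O (\<lambda>g. \<lambda>B\<in>?O. \<phi> g ` B)"
    using transitive_action.exists_derangement[OF normal_orbits_transitive_action[OF K]
        fin(1) finite_orbits orbits orbits] by blast
  then have g_carrier: "g \<in> carrier G" by (simp add: mem_derangements_iff)
  have "\<phi> (k \<otimes> g) z \<noteq> z" if k: "k \<in> K" and z: "z \<in> E" for k z
  proof
    assume "\<phi> (k \<otimes> g) z = z"
    then have "\<phi> g z = \<phi> (inv k) z"
      using act_inv[of k "\<phi> g z"] k z g_carrier by (simp add: composition_rule)
    then have "\<phi> g z \<in> ?orbit z" using K.m_inv_closed[OF k] by (auto simp: orbit_def)
    then have "\<phi> g ` ?orbit z = ?orbit z"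
      using normal_orbit_image[OF K g_carrier z] KA.orbit_eq_if_mem[OF z] by simp
    then show False using g orbits[OF z] by (simp add: mem_derangements_iff)
  qed
  then have "K #> g \<subseteq> derangements G E \<phi>"
    using g_carrier by (auto simp: r_coset_def mem_derangements_iff)
  then show ?thesis using that g_carrier by blast
qed

context faithful_action
begin

lemma eq_one_if_fixes_all:
  assumes "g \<in> carrier G" "\<And>x. x \<in> E \<Longrightarrow> \<phi> g x = x"
  shows "g = \<one>"
proof -
  have "\<phi> g \<in> extensional E" using bij_prop0[OF assms(1)] by (simp add: Bij_imp_extensional)
  then have "\<phi> g = (\<lambda>x\<in>E. x)" using assms(2) by (intro extensionalityI[of _ E]) auto
  then have "\<phi> g = \<phi> \<one>" using id_eq_one by simp
  then show ?thesis using faithful assms(1) by (auto dest: inj_onD)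
qed

lemma finite_carrier:
  assumes "finite E"
  shows "finite (carrier G)"
proof (rule inj_on_finite)
  show "inj_on \<phi> (carrier G)" by (rule faithful)
  show "\<phi> ` carrier G \<subseteq> E \<rightarrow>\<^sub>E E"
    using bij_prop0 by (auto simp: PiE_def Bij_imp_extensional)
  show "finite (E \<rightarrow>\<^sub>E E)" using assms by (simp add: finite_PiE)
qed

lemma normal_trivial_if_fixes_point:
  assumes "transitive_action G E \<phi>" and K: "K \<lhd> G" and x: "x \<in> E" "\<And>k. k \<in> K \<Longrightarrow> \<phi> k x = x"
  shows "K = {\<one>}"
proof -
  interpret transitive_action G E \<phi> by fact
  interpret K: normal K G by (rule K)
  have "k = \<one>" if k: "k \<in> K" for k
  proof (rule eq_one_if_fixes_all)
    fix y assume "y \<in> E"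
    then obtain g where g: "g \<in> carrier G" "\<phi> g x = y" using unique_orbit x by blast
    have "conjugate G (inv g) k \<in> K" using K g k by (simp add: normal_iff_conjugate)
    then show "\<phi> k y = y"
      using act_conjugate[of g "conjugate G (inv g) k" x] g k x by simp
  qed (use k in simp)
  then show ?thesis using K.one_closed by blast
qed

lemma semiregular_if_centralizer_transitive:
  assumes T: "T \<subseteq> carrier G"
    and K: "K \<subseteq> centralizer G T" "transitive_action (G\<lparr>carrier := K\<rparr>) E \<phi>"
  shows "semiregular (G\<lparr>carrier := T\<rparr>) E \<phi>"
  unfolding semiregular_def
proof (intro ballI impI)
  fix t x assume t: "t \<in> carrier (G\<lparr>carrier := T\<rparr>)" and x: "x \<in> E" "\<phi> t x = x"
  have "t = \<one>"
  proof (rule eq_one_if_fixes_all)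
    show t_carrier: "t \<in> carrier G" using t T by auto
    fix y assume "y \<in> E"
    then obtain k where k: "k \<in> K" "\<phi> k x = y"
      using transitive_action.unique_orbit[OF K(2) x(1)] by auto
    have "k \<in> carrier G" "conjugate G k t = t"
      using k(1) K(1) T t conjugate_by_centralizer by (auto simp: centralizer_def)
    then show "\<phi> t y = y" using act_conjugate[of k t x] t_carrier x k(2) by simp
  qed
  then show "t = \<one>\<^bsub>G\<lparr>carrier := T\<rparr>\<^esub>" by simp
qed

end

lemma (in group_action) card_carrier_eq_if_regular:
  assumes "transitive_action G E \<phi>" "semiregular G E \<phi>" "E \<noteq> {}"
  shows "card (carrier G) = card E"
proof -
  interpret transitive_action G E \<phi> by fact
  obtain x where x: "x \<in> E" using assms(3) by blast
  have "bij_betw (\<lambda>g. \<phi> g x) (carrier G) E"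
  proof (rule bij_betw_imageI)
    show "inj_on (\<lambda>g. \<phi> g x) (carrier G)" using assms(2) x by (rule semiregular_inj_on)
    show "(\<lambda>g. \<phi> g x) ` carrier G = E" using unique_orbit[OF x] x by auto
  qed
  then show ?thesis by (rule bij_betw_same_card)
qed

lemma (in group_action) sum_card_invariants_regular_coset:
  assumes N: "subgroup N G"
    and transitive: "transitive_action (G\<lparr>carrier := N\<rparr>) E \<phi>"
    and semiregular: "semiregular (G\<lparr>carrier := N\<rparr>) E \<phi>"
    and h: "h \<in> carrier G" and fin: "finite E" "finite N"
  shows "(\<Sum>n\<in>N. card (invariants E \<phi> (n \<otimes> h))) = card E"
proof -
  interpret N: subgroup N G by (rule N)
  interpret NA: transitive_action "G\<lparr>carrier := N\<rparr>" E \<phi> by (rule transitive)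
  have "invariants E \<phi> (n \<otimes> h) \<inter> invariants E \<phi> (m \<otimes> h) = {}"
    if nm: "n \<in> N" "m \<in> N" "n \<noteq> m" for n m
  proof -
    have "\<phi> n (\<phi> h z) \<noteq> \<phi> m (\<phi> h z)" if "z \<in> E" for z
      using NA.semiregular_inj_on[OF semiregular, of "\<phi> h z"] nm h that by (auto simp: inj_on_def)
    then show ?thesis using nm h by (fastforce simp: invariants_def composition_rule)
  qed
  then have "(\<Sum>n\<in>N. card (invariants E \<phi> (n \<otimes> h))) = card (\<Union>n\<in>N. invariants E \<phi> (n \<otimes> h))"
    using fin by (intro card_UN_disjoint[symmetric]) (auto simp: invariants_def)
  also have "(\<Union>n\<in>N. invariants E \<phi> (n \<otimes> h)) = E"
  proof
    show "E \<subseteq> (\<Union>n\<in>N. invariants E \<phi> (n \<otimes> h))"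
    proof
      fix z assume z: "z \<in> E"
      then obtain n where "n \<in> N" "\<phi> n (\<phi> h z) = z"
        using NA.unique_orbit[of "\<phi> h z" z] h by auto
      then show "z \<in> (\<Union>n\<in>N. invariants E \<phi> (n \<otimes> h))"
        using z h by (auto simp: invariants_def composition_rule)
    qed
  qed (auto simp: invariants_def)
  finally show ?thesis .
qed

lemma (in group_action) card_invariants_if_no_derangement_in_regular_coset:
  assumes N: "subgroup N G"
    and transitive: "transitive_action (G\<lparr>carrier := N\<rparr>) E \<phi>"
    and semiregular: "semiregular (G\<lparr>carrier := N\<rparr>) E \<phi>"
    and h: "h \<in> carrier G" and fin: "finite E" "finite N" and nonempty: "E \<noteq> {}"
    and no_derangement: "(N #> h) \<inter> derangements G E \<phi> = {}"
  shows "card (invariants E \<phi> h) = 1"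
proof -
  interpret N: subgroup N G by (rule N)
  interpret NA: transitive_action "G\<lparr>carrier := N\<rparr>" E \<phi> by (rule transitive)
  have "1 \<le> card (invariants E \<phi> (n \<otimes> h))" if n: "n \<in> N" for n
  proof -
    have "n \<otimes> h \<notin> derangements G E \<phi>"
      using n no_derangement by (auto simp: r_coset_def)
    then have "invariants E \<phi> (n \<otimes> h) \<noteq> {}" using n h by (simp add: derangements_def)
    moreover have "finite (invariants E \<phi> (n \<otimes> h))" using fin(1) by (simp add: invariants_def)
    ultimately show ?thesis by (simp add: Suc_le_eq card_gt_0_iff)
  qed
  moreover have "(\<Sum>n\<in>N. 1) = (\<Sum>n\<in>N. card (invariants E \<phi> (n \<otimes> h)))"
    using NA.card_carrier_eq_if_regular[OF transitive semiregular nonempty]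
      sum_card_invariants_regular_coset[OF N transitive semiregular h fin] by simp
  ultimately have "1 = card (invariants E \<phi> (\<one> \<otimes> h))"
    using fin(2) N.one_closed by (intro sum_mono_inv[of "\<lambda>_. 1" N]) auto
  then show ?thesis using h by simp
qed

context group
begin

lemma conj_class_eq_orbit:
  "a \<in> carrier G \<Longrightarrow> conj_class G a = orbit G (\<lambda>g. \<lambda>a\<in>carrier G. g \<otimes> a \<otimes> inv g) a"
  by (simp add: orbit_def conj_class_def)

lemma mem_conj_class_self: "a \<in> carrier G \<Longrightarrow> a \<in> conj_class G a"
  using group_action.orbit_refl[OF action_by_conjugation] by (simp add: conj_class_eq_orbit)

lemma conj_class_eq_if_mem:
  assumes a: "a \<in> carrier G" and b: "b \<in> conj_class G a"
  shows "conj_class G b = conj_class G a"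
proof -
  have "b \<in> carrier G" using a b by (auto simp: conj_class_eq_image)
  then show ?thesis
    using group_action.orbit_eq_if_mem[OF action_by_conjugation a] a b
    by (simp add: conj_class_eq_orbit)
qed

lemma card_conj_class:
  assumes a: "a \<in> carrier G"
  shows "card (conj_class G a) * card (centralizer G {a}) = order G"
proof -
  have "stabilizer G (\<lambda>g. \<lambda>a\<in>carrier G. g \<otimes> a \<otimes> inv g) a = centralizer G {a}"
    using a by (simp add: stabilizer_def centralizer_eq_fixes_conjugate conjugate_def)
  then show ?thesis
    using group_action.orbit_stabilizer_theorem[OF action_by_conjugation a] a
    by (simp add: conj_class_eq_orbit)
qed

lemma card_conj_classes_eq_1_iff:
  assumes D: "D \<subseteq> carrier G" and closed: "\<And>d. d \<in> D \<Longrightarrow> conj_class G d \<subseteq> D"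
  shows "card (conj_class G ` D) = 1 \<longleftrightarrow> (\<exists>d\<in>D. D = conj_class G d)"
proof
  assume "card (conj_class G ` D) = 1"
  then obtain A where A: "conj_class G ` D = {A}" by (rule card_1_singletonE)
  then have class_eq: "conj_class G d = A" if "d \<in> D" for d using that by auto
  obtain d where d: "d \<in> D" using A by (metis empty_is_image ex_in_conv insert_not_empty)
  have "D \<subseteq> conj_class G d"
  proof
    fix a assume a: "a \<in> D"
    then have "a \<in> conj_class G a" using D mem_conj_class_self by blast
    then show "a \<in> conj_class G d" using class_eq[OF a] class_eq[OF d] by simp
  qed
  then show "\<exists>d\<in>D. D = conj_class G d" using d closed by blast
next
  assume "\<exists>d\<in>D. D = conj_class G d"
  then obtain d where d: "d \<in> D" "D = conj_class G d" by blast
  then have "conj_class G a = conj_class G d" if "a \<in> D" for a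
    using that D conj_class_eq_if_mem[of d a] by blast
  then have "conj_class G ` D = {conj_class G d}" using d(1) by blast
  then show "card (conj_class G ` D) = 1" by simp
qed

end

subsection \<open>Sharply 2-transitive actions\<close>

locale sharply_2_transitive_action = group_action +
  assumes two_points: "\<exists>x\<in>E. \<exists>y\<in>E. x \<noteq> y"
    and unique_pair_map: "\<lbrakk>x \<in> E; y \<in> E; x \<noteq> y; x' \<in> E; y' \<in> E; x' \<noteq> y'\<rbrakk>
      \<Longrightarrow> \<exists>!g. g \<in> carrier G \<and> \<phi> g x = x' \<and> \<phi> g y = y'"
begin

sublocale transitive_action
proof
  fix x y assume xy: "x \<in> E" "y \<in> E"
  obtain x' y' where "x' \<in> E" "x' \<noteq> x" "y' \<in> E" "y' \<noteq> y" using two_points by metis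
  then show "\<exists>g\<in>carrier G. \<phi> g x = y" using unique_pair_map[of x x' y y'] xy by blast
qed

lemma eq_if_agree_on_pair:
  assumes "g \<in> carrier G" "h \<in> carrier G" "x \<in> E" "y \<in> E" "x \<noteq> y" "\<phi> g x = \<phi> h x" "\<phi> g y = \<phi> h y"
  shows "g = h"
proof -
  have "\<exists>!k. k \<in> carrier G \<and> \<phi> k x = \<phi> h x \<and> \<phi> k y = \<phi> h y"
    using assms by (intro unique_pair_map) simp_all
  then show ?thesis using assms by blast
qed

sublocale faithful_action
proof
  obtain x y where xy: "x \<in> E" "y \<in> E" "x \<noteq> y" using two_points by blast
  show "inj_on \<phi> (carrier G)"
    using eq_if_agree_on_pair[OF _ _ xy] by (intro inj_onI) simp
qed

lemma order_eq:
  assumes "finite E"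
  shows "order G = card E * (card E - 1)"
proof -
  obtain x y where xy: "x \<in> E" "y \<in> E" "x \<noteq> y" using two_points by blast
  have "bij_betw (\<lambda>g. (\<phi> g x, \<phi> g y)) (carrier G) (SIGMA u:E. E - {u})"
  proof (rule bij_betw_imageI)
    show "inj_on (\<lambda>g. (\<phi> g x, \<phi> g y)) (carrier G)"
      using eq_if_agree_on_pair xy by (intro inj_onI) auto
    have "(u, v) \<in> (\<lambda>g. (\<phi> g x, \<phi> g y)) ` carrier G" if "u \<in> E" "v \<in> E" "u \<noteq> v" for u v
      using unique_pair_map[OF xy that] by force
    then show "(\<lambda>g. (\<phi> g x, \<phi> g y)) ` carrier G = (SIGMA u:E. E - {u})"
      using xy by auto
  qed
  then have "order G = card (SIGMA u:E. E - {u})"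
    unfolding order_def by (rule bij_betw_same_card)
  then show ?thesis using assms by simp
qed

lemma card_derangements:
  assumes "finite E"
  shows "card (derangements G E \<phi>) = card E - 1"
proof -
  note fin = finite_carrier[OF assms]
  let ?D = "derangements G E \<phi>" and ?P = "carrier G - {\<one>}"
  have "E \<noteq> {}" using two_points by blast
  then have D: "?D \<subseteq> ?P" by (auto simp: mem_derangements_iff)
  have card_invariants: "card (invariants E \<phi> g) = (if g \<in> ?D then 0 else 1)" if g: "g \<in> ?P" for g
  proof (cases "g \<in> ?D")
    case False
    then obtain u where u: "u \<in> E" "\<phi> g u = u" using g by (auto simp: mem_derangements_iff)
    have unique: "v = u" if "v \<in> E" "\<phi> g v = v" for v
      using eq_if_agree_on_pair[of g \<one> u v] g u that by auto
    have "invariants E \<phi> g = {u}" unfolding invariants_def using u unique by blast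
    then show ?thesis using False by simp
  qed (simp add: derangements_def)
  have "order G = (\<Sum>g\<in>carrier G. card (invariants E \<phi> g))"
    using sum_card_invariants[OF fin assms \<open>E \<noteq> {}\<close>] by simp
  also have "\<dots> = card E + (\<Sum>g\<in>?P. card (invariants E \<phi> g))"
    using fin by (simp add: sum.remove[of _ \<one>])
  also have "(\<Sum>g\<in>?P. card (invariants E \<phi> g)) = (\<Sum>g\<in>?P. if g \<in> ?D then 0 else 1)"
    using card_invariants by (rule sum.cong[OF refl])
  also have "\<dots> = card (?P - ?D)"
    using fin by (simp add: sum.If_cases Diff_eq Collect_neg_eq)
  finally have "order G = card E + card (?P - ?D)" .
  moreover have "order G = Suc (card ?P)"
    unfolding order_def using fin one_closed by (rule card.remove)
  moreover have "card ?P = card ?D + card (?P - ?D)"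
    using fin card_Un_disjoint[of ?D "?P - ?D"] finite_subset[OF D] Un_absorb1[OF D] by simp
  ultimately show ?thesis by linarith
qed

text \<open>The centralizer of a derangement \<open>d\<close> is semiregular: together with \<open>x\<close>, an element of it fixes
  \<open>d x \<noteq> x\<close>.\<close>

lemma card_centralizer_derangement_le:
  assumes "finite E" and d: "d \<in> derangements G E \<phi>"
  shows "card (centralizer G {d}) \<le> card E"
proof -
  have d_carrier: "d \<in> carrier G" using d by (simp add: mem_derangements_iff)
  let ?C = "centralizer G {d}"
  have C: "subgroup ?C G" using d_carrier by (intro subgroup_centralizer) simp
  interpret C: group_action "G\<lparr>carrier := ?C\<rparr>" E \<phi> by (rule induced_action[OF C])
  have "c = \<one>" if c: "c \<in> ?C" and x: "x \<in> E" "\<phi> c x = x" for c x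
  proof (rule eq_if_agree_on_pair[of c \<one> x "\<phi> d x"])
    show c_carrier: "c \<in> carrier G" using c by (simp add: centralizer_def)
    have "conjugate G c d = d" using c d_carrier by (intro conjugate_by_centralizer[of "{d}"]) auto
    then show "\<phi> c (\<phi> d x) = \<phi> \<one> (\<phi> d x)"
      using act_conjugate[of c d x] c_carrier d_carrier x by simp
    show "x \<noteq> \<phi> d x" using d x by (metis mem_derangements_iff)
  qed (use x d_carrier in auto)
  then have "semiregular (G\<lparr>carrier := ?C\<rparr>) E \<phi>" by (simp add: semiregular_def)
  moreover obtain x where x: "x \<in> E" using two_points by blast
  ultimately have "inj_on (\<lambda>g. \<phi> g x) ?C" using C.semiregular_inj_on by simp
  moreover have "(\<lambda>g. \<phi> g x) ` ?C \<subseteq> E" using x by (auto simp: centralizer_def)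
  ultimately show ?thesis using assms(1) by (rule card_inj_on_le)
qed

lemma derangements_eq_conj_class:
  assumes fin: "finite E" and d: "d \<in> derangements G E \<phi>"
  shows "derangements G E \<phi> = conj_class G d"
proof -
  have d_carrier: "d \<in> carrier G" using d by (simp add: mem_derangements_iff)
  have "card E * (card E - 1) = card (conj_class G d) * card (centralizer G {d})"
    using card_conj_class[OF d_carrier] order_eq[OF fin] by simp
  also have "\<dots> \<le> card (conj_class G d) * card E"
    using card_centralizer_derangement_le[OF fin d] by (rule mult_le_mono2)
  finally have "card E * (card E - 1) \<le> card E * card (conj_class G d)"
    by (simp add: mult.commute)
  moreover have "card E > 0" using two_points fin by (auto simp: card_gt_0_iff)
  ultimately have "card (derangements G E \<phi>) \<le> card (conj_class G d)"
    using card_derangements[OF fin] by simp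
  moreover have "finite (derangements G E \<phi>)"
    using finite_carrier[OF fin] by (simp add: derangements_def)
  ultimately show ?thesis
    using conj_class_subset_derangements[OF d] card_seteq by metis
qed

end

subsection \<open>Quasiprimitive actions with a single class of derangements\<close>

locale quasiprimitive_action = faithful_action +
  assumes normal_transitive:
    "\<lbrakk>K \<lhd> G; K \<noteq> {\<one>}\<rbrakk> \<Longrightarrow> transitive_action (G\<lparr>carrier := K\<rparr>) E \<phi>"

locale quasiprimitive_single_derangement_class = quasiprimitive_action +
  fixes d
  assumes finite_points: "finite E"
    and nonempty: "E \<noteq> {}"
    and derangement: "d \<in> derangements G E \<phi>"
    and derangements_conjugate: "derangements G E \<phi> \<subseteq> conj_class G d"
begin

lemma finite_group: "finite (carrier G)"
  using finite_points by (rule finite_carrier)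

lemma exists_conjugate_derangement:
  assumes "a \<in> derangements G E \<phi>" "b \<in> derangements G E \<phi>"
  shows "\<exists>g\<in>carrier G. conjugate G g a = b"
proof -
  have "d \<in> carrier G" using derangement by (simp add: mem_derangements_iff)
  then have "b \<in> conj_class G a"
    using assms derangements_conjugate conj_class_eq_if_mem[of d a] by blast
  then show ?thesis by (auto simp: conj_class_eq_image)
qed

lemma semiregular_subgroup_center_nontrivial:
  assumes T: "subgroup T G" "T \<noteq> {\<one>}" and semiregular: "semiregular (G\<lparr>carrier := T\<rparr>) E \<phi>"
  shows "T \<inter> centralizer G T \<noteq> {\<one>}"
proof -
  interpret T: subgroup T G by (rule T)
  interpret TG: group "G\<lparr>carrier := T\<rparr>" by (rule T.subgroup_is_group[OF is_group])
  have fin: "finite (carrier (G\<lparr>carrier := T\<rparr>))"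
    using finite_subset[OF T.subset finite_group] by simp
  have ord_eq: "TG.ord a = TG.ord b" if ab: "a \<in> T" "b \<in> T" "a \<noteq> \<one>" "b \<noteq> \<one>" for a b
  proof -
    have "a \<in> derangements G E \<phi>" "b \<in> derangements G E \<phi>"
      using semiregular_diff_one_subset_derangements[OF T(1) semiregular] ab by blast+
    then obtain g where "g \<in> carrier G" "conjugate G g a = b"
      using exists_conjugate_derangement by blast
    then have "ord a = ord b" using ab ord_conjugate by auto
    then show ?thesis using ab T(1) by (simp add: ord_subgroup)
  qed
  have "\<exists>p n. Factorial_Ring.prime (p::nat) \<and> order (G\<lparr>carrier := T\<rparr>) = p ^ n"
    using T(2) by (intro TG.order_prime_power_if_ord_constant[OF fin]) (simp, rule ord_eq, simp_all)
  then have "centralizer (G\<lparr>carrier := T\<rparr>) (carrier (G\<lparr>carrier := T\<rparr>)) \<noteq> {\<one>}"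
    using TG.center_nontrivial_if_prime_power_order[OF fin] T(2) by auto
  then show ?thesis by (simp add: centralizer_restrict T.subset)
qed

lemma exists_derangement_centralizer_coset:
  assumes N: "minimal_normal G N" and T: "minimal_normal (G\<lparr>carrier := N\<rparr>) T"
  defines "C \<equiv> N \<inter> centralizer G T"
  assumes intransitive: "\<not> transitive_action (G\<lparr>carrier := C\<rparr>) E \<phi>"
  obtains t where "t \<in> T" "C #> t \<subseteq> derangements G E \<phi>"
proof -
  interpret N: normal N G using N by (simp add: minimal_normal_def)
  interpret NA: transitive_action "G\<lparr>carrier := N\<rparr>" E \<phi>
    using N by (intro normal_transitive) (simp_all add: minimal_normal_def)
  have T_normal: "T \<lhd> G\<lparr>carrier := N\<rparr>" using T by (simp add: minimal_normal_def)
  then interpret T: subgroup T G by (simp add: normal_subgroup_iff N.subgroup_axioms)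
  have C_normal: "C \<lhd> G\<lparr>carrier := N\<rparr>"
    using NA.normal_centralizer[OF T_normal] by (simp add: C_def centralizer_restrict N.subset)
  then interpret C: subgroup C G by (simp add: normal_subgroup_iff N.subgroup_axioms)
  have fin: "finite (carrier (G\<lparr>carrier := N\<rparr>))"
    using finite_subset[OF N.subset finite_group] by simp
  obtain n where n: "n \<in> N"
      "C #>\<^bsub>G\<lparr>carrier := N\<rparr>\<^esub> n \<subseteq> derangements (G\<lparr>carrier := N\<rparr>) E \<phi>"
    using NA.exists_coset_of_derangements[OF fin finite_points C_normal] intransitive by auto
  then have Cn: "C #> n \<subseteq> derangements G E \<phi>"
    by (auto simp: r_coset_def mem_derangements_iff)
  obtain t c where tc: "t \<in> T" "c \<in> C" "n = t \<otimes> c"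
    using n(1) minimal_normal_eq_product[OF N T] unfolding C_def set_mult_def by blast
  moreover from this have "c \<otimes> t = t \<otimes> c" unfolding C_def centralizer_def by blast
  ultimately have "n = c \<otimes> t" by metis
  then have "C #> n = C #> t"
    using coset_mult_assoc[OF C.subset, of c t] C.rcos_const[OF is_group tc(2)] tc(1,2) by simp
  then show ?thesis using that[OF tc(1)] Cn by simp
qed

text \<open>A conjugate of \<open>t \<in> T\<close> lies in \<open>T\<close> or in \<open>C\<close>, but \<open>c t\<close> lies in neither for
  \<open>1 \<noteq> c \<in> C\<close>. So \<open>t\<close> and \<open>c t\<close> cannot both be derangements.\<close>

lemma centralizer_trivial_or_transitive:
  assumes N: "minimal_normal G N" and T: "minimal_normal (G\<lparr>carrier := N\<rparr>) T"
    and centerless: "T \<inter> centralizer G T = {\<one>}"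
  defines "C \<equiv> N \<inter> centralizer G T"
  shows "C = {\<one>} \<or> transitive_action (G\<lparr>carrier := C\<rparr>) E \<phi>"
proof (rule ccontr)
  assume neither: "\<not> ?thesis"
  interpret N: normal N G using N by (simp add: minimal_normal_def)
  interpret T: subgroup T G
    using T by (simp add: minimal_normal_def normal_subgroup_iff N.subgroup_axioms)
  interpret C: subgroup C G
    unfolding C_def using N.subgroup_axioms subgroup_centralizer[OF T.subset]
    by (rule subgroups_Inter_pair)
  obtain c where c: "c \<in> C" "c \<noteq> \<one>" using neither C.one_closed by blast
  obtain t where t: "t \<in> T" "C #> t \<subseteq> derangements G E \<phi>"
    using exists_derangement_centralizer_coset[OF N T] neither unfolding C_def by blast
  then have ct_derangement: "b \<otimes> t \<in> derangements G E \<phi>" if "b \<in> C" for b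
    using that by (auto simp: r_coset_def)
  have t_derangement: "t \<in> derangements G E \<phi>" using ct_derangement[OF C.one_closed] t by simp
  then obtain g where g: "g \<in> carrier G" "conjugate G g t = c \<otimes> t"
    using exists_conjugate_derangement ct_derangement[OF c(1)] by blast
  then have "c \<otimes> t \<in> conjugate G g ` T" using t(1) by force
  then have "c \<otimes> t \<in> T \<or> c \<otimes> t \<in> C"
    using conjugate_minimal_normal_cases[OF N.normal_axioms T g(1)] unfolding C_def by blast
  then show False
  proof
    assume "c \<otimes> t \<in> T"
    then have "c \<otimes> t \<otimes> inv t \<in> T" using t by simp
    then have "c \<in> T" using c t by (simp add: m_assoc)
    then show False using c centerless by (auto simp: C_def)
  next
    assume "c \<otimes> t \<in> C"
    then have "inv c \<otimes> (c \<otimes> t) \<in> C" using c by simp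
    then have "t \<in> C" using c t by (simp flip: m_assoc)
    then have "t = \<one>" using t centerless by (auto simp: C_def)
    then show False using t_derangement nonempty by (auto simp: mem_derangements_iff)
  qed
qed

lemma minimal_normal_abelian:
  assumes not_almost_simple: "\<not> almost_simple G" and N: "minimal_normal G N"
  shows "N \<subseteq> centralizer G N"
proof (rule ccontr)
  assume nonabelian: "\<not> N \<subseteq> centralizer G N"
  interpret N: normal N G using N by (simp add: minimal_normal_def)
  interpret NG: group "G\<lparr>carrier := N\<rparr>" by (rule N.subgroup_is_group[OF is_group])
  have "finite N" "N \<noteq> {\<one>}"
    using finite_subset[OF N.subset finite_group] N by (simp_all add: minimal_normal_def)
  then obtain T where T: "minimal_normal (G\<lparr>carrier := N\<rparr>) T"
    using NG.minimal_normal_exists by auto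
  have centerless: "T \<inter> centralizer G T = {\<one>}"
    using N T nonabelian by (rule minimal_normal_centerless)
  have T_sub: "subgroup T G" "T \<noteq> {\<one>}"
    using T by (simp_all add: minimal_normal_def normal_subgroup_iff N.subgroup_axioms)
  have no_transitive: "\<not> transitive_action (G\<lparr>carrier := K\<rparr>) E \<phi>" if "K \<subseteq> centralizer G T" for K
    using semiregular_if_centralizer_transitive[OF subgroup.subset[OF T_sub(1)] that]
      semiregular_subgroup_center_nontrivial[OF T_sub] centerless by blast
  then have "N \<inter> centralizer G T = {\<one>}"
    using centralizer_trivial_or_transitive[OF N T centerless] by blast
  then have "T #> \<one> = N"
    using minimal_normal_eq_product[OF N T] by (simp add: r_coset_eq_set_mult)
  then have "T = N" using subgroup.subset[OF T_sub(1)] by simp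
  then have "centralizer G N = {\<one>}"
    using no_transitive normal_transitive[OF normal_centralizer[OF N.normal_axioms]] by blast
  then have "almost_simple G"
    using finite_group N.normal_axioms T \<open>T = N\<close> nonabelian
    by (intro almost_simple_if_nonabelian_simple_normal) simp_all
  then show False using not_almost_simple by blast
qed

context
  fixes N
  assumes N: "N \<lhd> G" "N \<noteq> {\<one>}" and abelian: "N \<subseteq> centralizer G N"
begin

interpretation N: normal N G by (rule N(1))
interpretation NA: transitive_action "G\<lparr>carrier := N\<rparr>" E \<phi>
  using N by (rule normal_transitive)

lemma abelian_normal_semiregular: "semiregular (G\<lparr>carrier := N\<rparr>) E \<phi>"
  using N.subset abelian NA.transitive_action_axioms by (rule semiregular_if_centralizer_transitive)

lemma derangements_eq_abelian_normal: "derangements G E \<phi> = N - {\<one>}"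
proof
  show N_derangements: "N - {\<one>} \<subseteq> derangements G E \<phi>"
    using N.subgroup_axioms abelian_normal_semiregular
    by (rule semiregular_diff_one_subset_derangements)
  show "derangements G E \<phi> \<subseteq> N - {\<one>}"
  proof
    fix a assume a: "a \<in> derangements G E \<phi>"
    obtain n where "n \<in> N" "n \<noteq> \<one>" using N(2) N.one_closed by blast
    moreover from this obtain g where "g \<in> carrier G" "conjugate G g n = a"
      using exists_conjugate_derangement[OF _ a] N_derangements by blast
    ultimately have "a \<in> N" using N(1) by (auto simp: normal_iff_conjugate)
    moreover have "a \<noteq> \<one>" using a nonempty by (auto simp: mem_derangements_iff)
    ultimately show "a \<in> N - {\<one>}" by blast
  qed
qed

lemma eq_one_if_fixes_two_points:
  assumes h: "h \<in> carrier G" and xy: "x \<in> E" "y \<in> E" "x \<noteq> y" and fixes_xy: "\<phi> h x = x" "\<phi> h y = y"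
  shows "h = \<one>"
proof (cases "h \<in> N")
  case True
  then show ?thesis using abelian_normal_semiregular xy(1) fixes_xy(1) by (auto simp: semiregular_def)
next
  case False
  have "n \<otimes> h \<notin> N" if n: "n \<in> N" for n
  proof
    assume "n \<otimes> h \<in> N"
    then have "inv n \<otimes> (n \<otimes> h) \<in> N" using n by simp
    then show False using n h False by (simp flip: m_assoc)
  qed
  then have "(N #> h) \<inter> derangements G E \<phi> = {}"
    by (auto simp: derangements_eq_abelian_normal r_coset_def)
  then have "card (invariants E \<phi> h) = 1"
    using finite_subset[OF N.subset finite_group]
    by (intro card_invariants_if_no_derangement_in_regular_coset[OF N.subgroup_axioms
          NA.transitive_action_axioms abelian_normal_semiregular h finite_points _ nonempty])
  moreover have "{x, y} \<subseteq> invariants E \<phi> h" using xy fixes_xy by (auto simp: invariants_def)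
  ultimately show ?thesis using xy(3) by (auto simp: card_1_singleton_iff)
qed

lemma exists_pair_map:
  assumes xy: "x \<in> E" "y \<in> E" "x \<noteq> y" and xy': "x' \<in> E" "y' \<in> E" "x' \<noteq> y'"
  shows "\<exists>g\<in>carrier G. \<phi> g x = x' \<and> \<phi> g y = y'"
proof -
  obtain n where n: "n \<in> N" "\<phi> n x = y" using NA.unique_orbit[OF xy(1,2)] by auto
  obtain n' where n': "n' \<in> N" "\<phi> n' x' = y'" using NA.unique_orbit[OF xy'(1,2)] by auto
  have "n \<in> derangements G E \<phi>" "n' \<in> derangements G E \<phi>"
    using n n' xy xy' by (auto simp: derangements_eq_abelian_normal)
  then obtain g where g: "g \<in> carrier G" "conjugate G g n = n'"
    using exists_conjugate_derangement by blast
  obtain m where m: "m \<in> N" "\<phi> m (\<phi> g x) = x'"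
    using NA.unique_orbit[of "\<phi> g x" x'] g xy xy' by auto
  have "conjugate G (m \<otimes> g) n = conjugate G m n'"
    using g n m by (simp flip: conjugate_conjugate)
  also have "\<dots> = n'"
    using abelian m n' by (intro conjugate_by_centralizer[OF N.subset]) auto
  finally have "\<phi> n' (\<phi> (m \<otimes> g) x) = \<phi> (m \<otimes> g) (\<phi> n x)"
    using act_conjugate[of "m \<otimes> g" n x] m g n xy by simp
  moreover have "\<phi> (m \<otimes> g) x = x'" using m g xy by (simp add: composition_rule)
  ultimately have "\<phi> (m \<otimes> g) x = x' \<and> \<phi> (m \<otimes> g) y = y'" using n n' by simp
  then show ?thesis using m g by (intro bexI[of _ "m \<otimes> g"]) simp_all
qed

lemma sharply_2_transitive_if_abelian_normal: "sharply_2_transitive_action G E \<phi>"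
proof (intro sharply_2_transitive_action.intro sharply_2_transitive_action_axioms.intro)
  show "group_action G E \<phi>" by (rule group_action_axioms)
  obtain x where "x \<in> E" using nonempty by blast
  then have "\<phi> d x \<in> E" "x \<noteq> \<phi> d x" using derangement by (auto simp: mem_derangements_iff)
  then show "\<exists>x\<in>E. \<exists>y\<in>E. x \<noteq> y" using \<open>x \<in> E\<close> by blast
next
  fix x y x' y' assume xy: "x \<in> E" "y \<in> E" "x \<noteq> y" and xy': "x' \<in> E" "y' \<in> E" "x' \<noteq> y'"
  have "g = h" if g: "g \<in> carrier G" "\<phi> g x = x'" "\<phi> g y = y'"
    and h: "h \<in> carrier G" "\<phi> h x = x'" "\<phi> h y = y'" for g h
  proof -
    have "\<phi> (inv h \<otimes> g) x = x" "\<phi> (inv h \<otimes> g) y = y"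
      using g h(1) xy act_inv[OF h(1) xy(1), unfolded h(2)] act_inv[OF h(1) xy(2), unfolded h(3)]
      by (simp_all add: composition_rule)
    then have "inv h \<otimes> g = \<one>"
      using g h xy by (intro eq_one_if_fixes_two_points[of _ x y]) simp_all
    then show ?thesis using g h by (metis inv_closed inv_equality inv_inv)
  qed
  then show "\<exists>!g. g \<in> carrier G \<and> \<phi> g x = x' \<and> \<phi> g y = y'"
    using exists_pair_map[OF xy xy'] by blast
qed

end

theorem sharply_2_transitive_if_not_almost_simple:
  assumes "\<not> almost_simple G"
  shows "sharply_2_transitive_action G E \<phi>"
proof -
  have "d \<in> carrier G" "d \<noteq> \<one>"
    using derangement nonempty by (auto simp: mem_derangements_iff)
  then obtain N where N: "minimal_normal G N"
    using minimal_normal_exists[OF finite_group] by blast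
  then show ?thesis
    using minimal_normal_abelian[OF assms N]
    by (intro sharply_2_transitive_if_abelian_normal[of N]) (simp_all add: minimal_normal_def)
qed

end

subsection \<open>Permutation groups\<close>

lemma perm_group_faithful_action:
  assumes "perm_group \<Omega> G"
  shows "faithful_action (PG \<Omega> G) \<Omega> (\<lambda>g. g)"
proof -
  have G: "subgroup G (BijGroup \<Omega>)" using assms by (simp add: perm_group_def)
  have "group_hom (BijGroup \<Omega>) (BijGroup \<Omega>) (\<lambda>g. g)"
    using group_BijGroup by (auto simp: group_hom_def group_hom_axioms_def hom_def)
  then have "group_action (BijGroup \<Omega>) \<Omega> (\<lambda>g. g)" by (rule group_action.intro)
  then have "group_action (PG \<Omega> G) \<Omega> (\<lambda>g. g)" using G by (rule group_action.induced_action)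
  then show ?thesis by (simp add: faithful_action_def faithful_action_axioms_def)
qed

lemma derangements_perm_group: "derangements (PG \<Omega> G) \<Omega> (\<lambda>g. g) = {g \<in> G. derangement \<Omega> g}"
  by (auto simp: mem_derangements_iff derangement_def)

lemma kappa_eq_1_iff:
  assumes "perm_group \<Omega> G"
  defines "D \<equiv> derangements (PG \<Omega> G) \<Omega> (\<lambda>g. g)"
  shows "kappa \<Omega> G = 1 \<longleftrightarrow> (\<exists>d\<in>D. D = conj_class (PG \<Omega> G) d)"
proof -
  interpret faithful_action "PG \<Omega> G" \<Omega> "\<lambda>g. g"
    using assms(1) by (rule perm_group_faithful_action)
  have mem_D: "d \<in> D \<longleftrightarrow> d \<in> G \<and> derangement \<Omega> d" for d
    by (simp add: D_def derangements_perm_group)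
  have closed: "conj_class (PG \<Omega> G) d \<subseteq> D" if "d \<in> D" for d
    using that unfolding D_def by (rule conj_class_subset_derangements)
  have "g \<in> conj_class (PG \<Omega> G) g" if "g \<in> G" for g
    using that by (intro mem_conj_class_self) simp
  then have "{C. \<exists>g\<in>G. C = conj_class (PG \<Omega> G) g \<and> (\<forall>h\<in>C. derangement \<Omega> h)}
      = conj_class (PG \<Omega> G) ` D"
    using closed mem_D by blast
  moreover have "D \<subseteq> carrier (PG \<Omega> G)" by (auto simp: mem_D)
  ultimately show ?thesis
    using card_conj_classes_eq_1_iff[OF _ closed] by (simp add: kappa_def)
qed

lemma sharply_2_transitive_iff_action:
  assumes "perm_group \<Omega> G"
  shows "sharply_2_transitive \<Omega> G \<longleftrightarrow> sharply_2_transitive_action (PG \<Omega> G) \<Omega> (\<lambda>g. g)"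
proof -
  have pairs: "(\<forall>x\<in>\<Omega>. \<forall>y\<in>\<Omega>. \<forall>x'\<in>\<Omega>. \<forall>y'\<in>\<Omega>. x \<noteq> y \<longrightarrow> x' \<noteq> y' \<longrightarrow> P x y x' y') \<longleftrightarrow>
      (\<forall>x y x' y'. x \<in> \<Omega> \<longrightarrow> y \<in> \<Omega> \<longrightarrow> x \<noteq> y \<longrightarrow> x' \<in> \<Omega> \<longrightarrow> y' \<in> \<Omega> \<longrightarrow> x' \<noteq> y' \<longrightarrow> P x y x' y')"
    for P by blast
  have "group_action (PG \<Omega> G) \<Omega> (\<lambda>g. g)"
    using perm_group_faithful_action[OF assms] by (rule faithful_action.axioms(1))
  then show ?thesis
    unfolding sharply_2_transitive_def sharply_2_transitive_action_def
      sharply_2_transitive_action_axioms_def pairs by simp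
qed

lemma is_block_normal_orbit:
  assumes perm: "perm_group \<Omega> G" and K: "K \<lhd> PG \<Omega> G" and x: "x \<in> \<Omega>"
  shows "is_block \<Omega> G (orbit ((PG \<Omega> G)\<lparr>carrier := K\<rparr>) (\<lambda>g. g) x)" (is "is_block \<Omega> G ?B")
  unfolding is_block_def
proof (intro conjI ballI)
  interpret faithful_action "PG \<Omega> G" \<Omega> "\<lambda>g. g"
    using perm by (rule perm_group_faithful_action)
  interpret KA: group_action "(PG \<Omega> G)\<lparr>carrier := K\<rparr>" \<Omega> "\<lambda>g. g"
    using K by (intro induced_action normal_imp_subgroup)
  show "?B \<subseteq> \<Omega>" using KA.orbits_coverture x by (auto simp: orbits_def)
  show "?B \<noteq> {}" using KA.orbit_refl[OF x] by blast
  fix g assume "g \<in> G"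
  then have "g ` ?B = orbit ((PG \<Omega> G)\<lparr>carrier := K\<rparr>) (\<lambda>g. g) (g x)" "g x \<in> \<Omega>"
    using normal_orbit_image[OF K _ x] act_closed[OF _ x] by simp_all
  then show "g ` ?B = ?B \<or> g ` ?B \<inter> ?B = {}"
    using x by (intro KA.disjoint_union) (auto simp: orbits_def)
qed

lemma primitive_quasiprimitive_action:
  assumes perm: "perm_group \<Omega> G" and prim: "primitive \<Omega> G"
  shows "quasiprimitive_action (PG \<Omega> G) \<Omega> (\<lambda>g. g)"
proof -
  interpret faithful_action "PG \<Omega> G" \<Omega> "\<lambda>g. g"
    using perm by (rule perm_group_faithful_action)
  have transitive: "transitive_action (PG \<Omega> G) \<Omega> (\<lambda>g. g)"
    using prim group_action_axioms
    by (auto simp: primitive_def transitive_on_def transitive_action_def transitive_action_axioms_def)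
  show ?thesis
  proof (intro quasiprimitive_action.intro quasiprimitive_action_axioms.intro)
    show "faithful_action (PG \<Omega> G) \<Omega> (\<lambda>g. g)" by (rule faithful_action_axioms)
    fix K assume K: "K \<lhd> PG \<Omega> G" "K \<noteq> {\<one>\<^bsub>PG \<Omega> G\<^esub>}"
    let ?K = "(PG \<Omega> G)\<lparr>carrier := K\<rparr>"
    interpret KA: group_action ?K \<Omega> "\<lambda>g. g"
      using K(1) by (intro induced_action normal_imp_subgroup)
    have "orbit ?K (\<lambda>g. g) x = \<Omega>" if x: "x \<in> \<Omega>" for x
    proof -
      have "card (orbit ?K (\<lambda>g. g) x) \<noteq> 1"
      proof
        assume "card (orbit ?K (\<lambda>g. g) x) = 1"
        then have "orbit ?K (\<lambda>g. g) x = {x}"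
          using KA.orbit_refl[OF x] by (metis card_1_singletonE singletonD)
        then have "k x = x" if "k \<in> K" for k using that by (auto simp: orbit_def)
        then show False using normal_trivial_if_fixes_point[OF transitive K(1) x] K(2) by blast
      qed
      then show ?thesis
        using is_block_normal_orbit[OF perm K(1) x] prim unfolding primitive_def by blast
    qed
    then show "transitive_action ?K \<Omega> (\<lambda>g. g)"
      unfolding KA.transitive_action_iff_orbit by blast
  qed
qed

theorem theorem2p1:
  fixes \<Omega> :: "'a set" and G :: "('a \<Rightarrow> 'a) set"
  assumes "finite \<Omega>"
    and "perm_group \<Omega> G"
    and "primitive \<Omega> G"
    and "\<not> almost_simple (PG \<Omega> G)"
  shows "kappa \<Omega> G = 1 \<longleftrightarrow> sharply_2_transitive \<Omega> G"
  unfolding kappa_eq_1_iff[OF assms(2)] sharply_2_transitive_iff_action[OF assms(2)]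
proof
  let ?D = "derangements (PG \<Omega> G) \<Omega> (\<lambda>g. g)"
  assume "\<exists>d\<in>?D. ?D = conj_class (PG \<Omega> G) d"
  then obtain d where d: "d \<in> ?D" "?D \<subseteq> conj_class (PG \<Omega> G) d" by blast
  have "\<Omega> \<noteq> {}" using assms(3) by (simp add: primitive_def transitive_on_def)
  then interpret quasiprimitive_single_derangement_class "PG \<Omega> G" \<Omega> "\<lambda>g. g" d
    using primitive_quasiprimitive_action[OF assms(2,3)] assms(1) d
    by (intro quasiprimitive_single_derangement_class.intro
        quasiprimitive_single_derangement_class_axioms.intro)
  show "sharply_2_transitive_action (PG \<Omega> G) \<Omega> (\<lambda>g. g)"
    using assms(4) by (rule sharply_2_transitive_if_not_almost_simple)
next
  let ?D = "derangements (PG \<Omega> G) \<Omega> (\<lambda>g. g)"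
  assume "sharply_2_transitive_action (PG \<Omega> G) \<Omega> (\<lambda>g. g)"
  then interpret sharply_2_transitive_action "PG \<Omega> G" \<Omega> "\<lambda>g. g" .
  obtain d where "d \<in> ?D"
    using exists_derangement[OF finite_carrier[OF assms(1)] assms(1)] two_points by blast
  then show "\<exists>d\<in>?D. ?D = conj_class (PG \<Omega> G) d"
    using derangements_eq_conj_class[OF assms(1)] by blast
qed

end
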